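(* Let $\mathbb{A}$ be a $k$-letter alphabet, $\pi=(<_D,<_A)$ a pair of distinct total orders on $\mathbb{A}$, $\Omega$ the associated $k\times k$ matrix, and let $\mathcal{F}=(v_1,\ldots,v_n)$ be a primitive family over $\mathbb{A}$. If $\mathcal{F}$ is $\pi$-clustering, then $n\le\lfloor\frac{k+d}{2}\rfloor$ where $d=\dim\ker(\Omega)$. If $\mathcal{F}$ is perfectly clustering, then $n\le\lfloor\frac{k+1}{2}\rfloor$; moreover, this last bound is optimal, i.e. on a $k$-letter alphabet there exists a primitive perfectly clustering family consisting of exactly $\lfloor\frac{k+1}{2}\rfloor$ words.
   Context: $\Omega=(\Omega_{i,j})_{i,j\in\mathbb{A}}$ is the real skew-symmetric matrix with $\Omega_{i,j}=+1$ if $j<_A i$ and $i<_D j$; $\Omega_{i,j}=-1$ if $j<_D i$ and $i<_A j$; $\Omega_{i,j}=0$ otherwise. For nonempty words $w,z$ put $w^\omega=www\cdots$ and $w^{-\omega}=\cdots www$. Write $w<_D z$ if $w^\omega$ is lexicographically smaller than $z^\omega$ with respect to $<_D$ (reading left to right), and $w<_A z$ if $w^{-\omega}$ is reverse-lexicographically smaller than $z^{-\omega}$ with respect to $<_A$ (reading right to left). A family $\mathcal{F}=(v_1,\ldots,v_n)$ of nonempty words is $\pi$-clustering if for all $1\le i,j\le n$ and all conjugates (cyclic rotations) $u$ of $v_i$ and $v$ of $v_j$, $u<_A v\Leftrightarrow u<_D v$. A pair $\pi$ is symmetric if $a<_D b\Leftrightarrow b<_A a$ for all letters $a,b$; $\mathcal{F}$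 is perfectly clustering if it is $\pi$-clustering for some symmetric pair of orders $\pi$ on $\mathbb{A}$. The family is primitive if each $v_i$ is primitive (not a proper power) and the $v_i$ are pairwise non-conjugate. *)

theory Defs
  imports "HOL-Analysis.Analysis" "HOL-Library.Omega_Words_Fun"
begin

text \<open>
  The alphabet is a finite type \<open>'a\<close>, finite words are lists, and a family of words
  \<open>(v\<^sub>1, \<dots>, v\<^sub>n)\<close> is a list of words. Orders on letters are strict and given as
  relations: \<open>(a, b) \<in> D\<close> means that \<open>a\<close> is smaller than \<open>b\<close>. A pair of orders is
  passed as two arguments, the order \<open>D\<close> first and the order \<open>A\<close> second.
\<close>

definition Omega :: "'a rel \<Rightarrow> 'a rel \<Rightarrow> real ^ 'a ^ 'a::finite" where
  "Omega D A = (\<chi> i j.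
     if (j, i) \<in> A \<and> (i, j) \<in> D then 1
     else if (j, i) \<in> D \<and> (i, j) \<in> A then -1
     else 0)"

definition lex_less :: "'a rel \<Rightarrow> 'a word \<Rightarrow> 'a word \<Rightarrow> bool" where
  "lex_less r x y \<longleftrightarrow> (\<exists>n. (\<forall>m<n. x m = y m) \<and> (x n, y n) \<in> r)"

definition less_D :: "'a rel \<Rightarrow> 'a list \<Rightarrow> 'a list \<Rightarrow> bool" where
  "less_D D w z \<longleftrightarrow> lex_less D (iter w) (iter z)"

text \<open>
  Reading the left-infinite word \<open>\<dots>www\<close> from right to left gives the
  right-infinite word \<open>iter (rev w)\<close>.
\<close>

definition less_A :: "'a rel \<Rightarrow> 'a list \<Rightarrow> 'a list \<Rightarrow> bool" where
  "less_A A w z \<longleftrightarrow> lex_less A (iter (rev w)) (iter (rev z))"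

definition conjugate :: "'a list \<Rightarrow> 'a list \<Rightarrow> bool" where
  "conjugate u v \<longleftrightarrow> (\<exists>m. u = rotate m v)"

definition primitive_word :: "'a list \<Rightarrow> bool" where
  "primitive_word w \<longleftrightarrow> w \<noteq> [] \<and> \<not> (\<exists>u m. m \<ge> 2 \<and> w = concat (replicate m u))"

definition primitive_family :: "'a list list \<Rightarrow> bool" where
  "primitive_family F \<longleftrightarrow>
     (\<forall>i<length F. primitive_word (F ! i)) \<and>
     (\<forall>i<length F. \<forall>j<length F. i \<noteq> j \<longrightarrow> \<not> conjugate (F ! i) (F ! j))"

definition clustering :: "'a rel \<Rightarrow> 'a rel \<Rightarrow> 'a list list \<Rightarrow> bool" where
  "clustering D A F \<longleftrightarrow>
     (\<forall>i<length F. F ! i \<noteq> []) \<and>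
     (\<forall>i<length F. \<forall>j<length F. \<forall>u v.
        conjugate u (F ! i) \<longrightarrow> conjugate v (F ! j) \<longrightarrow> (less_A A u v \<longleftrightarrow> less_D D u v))"

definition symmetric_orders :: "'a rel \<Rightarrow> 'a rel \<Rightarrow> bool" where
  "symmetric_orders D A \<longleftrightarrow> (\<forall>a b. (a, b) \<in> D \<longleftrightarrow> (b, a) \<in> A)"

definition perfectly_clustering :: "'a list list \<Rightarrow> bool" where
  "perfectly_clustering F \<longleftrightarrow>
     (\<exists>D A. strict_linear_order D \<and> strict_linear_order A \<and> symmetric_orders D A \<and>
            clustering D A F)"

end

theory Submission
  imports Defs
begin

text \<open>
  Write \<open>n\<close> for the number of words, \<open>k\<close> for the number of letters and \<open>d\<close> for the dimension of
  the kernel of \<open>\<Omega>\<close>.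

  Repeat each rotation of each word of the family forever. This gives finitely many periodic
  points, permuted by the shift \<open>S\<close> and ordered lexicographically by \<open>D\<close>. The points that begin
  with a letter \<open>a\<close> form a block, the blocks are ordered by \<open>D\<close>, and \<open>S\<close> preserves the order
  inside a block. Clustering says that the images of the blocks are again blocks, now ordered by
  \<open>A\<close>. So \<open>S\<close> is a discrete interval exchange. Give each point of the word \<open>v\<close> a mass \<open>c v\<close>, for
  arbitrary real \<open>c\<close>. Then the mass below a point that begins with \<open>a\<close> changes under \<open>S\<close> by the entry at \<open>a\<close> of \<open>\<Omega> \<mu>\<close>, where \<open>\<mu>\<close> is the Parikh vector of the
  weighted family (\<open>mass_below_shift\<close>).

  Two consequences carry the upper bounds. First, the translations along a periodic orbit add up
  to zero; letting \<open>c\<close> charge a single word gives \<open>p \<bullet> \<Omega> q = 0\<close> for all Parikh vectors \<open>p\<close>,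
  \<open>q\<close> of words of the family (\<open>parikh_isotropic\<close>). Second, these vectors are linearly independent.
  Separating the positive from the negative coefficients of a nontrivial linear relation gives two
  nonnegative weights with disjoint supports and the same \<open>\<mu>\<close>, hence with the same interval
  exchange. The least points of their supports have mass zero below them, so they follow the same
  itinerary and are the same infinite word; as the words of the family are primitive, two different
  ones would then be conjugate (\<open>parikh_scalars_zero\<close>). An isotropic subspace \<open>W\<close> is orthogonal to its image \<open>\<Omega> W\<close>, whose
  dimension is at least \<open>dim W - d\<close>; hence \<open>2 n \<le> k + d\<close>.

  For a symmetric pair of orders, subtracting two rows of \<open>\<Omega> x = 0\<close> shows that an element of
  the kernel is determined by its coordinate at the least letter, so \<open>d \<le> 1\<close>. The bound is
  attained by the words \<open>a \<sigma>(a)\<close>, where \<open>\<sigma>\<close> is the order-reversing involution of the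
  alphabet, with the one-letter word \<open>a\<close> in place of \<open>a \<sigma>(a)\<close> if \<open>\<sigma>\<close> fixes \<open>a\<close>.
\<close>

section \<open>Words and their periodic repetitions\<close>

lemma iter_rotate_nth:
  assumes "v \<noteq> []"
  shows "iter (rotate r v) m = v ! ((r + m) mod length v)"
  using assms by (simp add: nth_rotate mod_add_right_eq)

lemma iter_rotate_Suc:
  assumes "v \<noteq> []"
  shows "iter (rotate (Suc r) v) m = iter (rotate r v) (Suc m)"
  by (simp only: iter_rotate_nth[OF assms] add_Suc add_Suc_right)

text \<open>
  Clustering compares words read backwards. The first letter of the reversed reading, taken one
  step further along the orbit, is the letter that the shift has just removed. This is how the
  order \<open>A\<close> comes to sort the images of the blocks.
\<close>

lemma iter_rev_rotate_Suc_0: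
  assumes "v \<noteq> []"
  shows "iter (rev (rotate (Suc r) v)) 0 = iter (rotate r v) 0"
proof -
  have ne: "rotate r v \<noteq> []"
    using assms by simp
  have "iter (rev (rotate (Suc r) v)) 0 = hd (rev (rotate1 (rotate r v)))"
    using assms by (simp add: hd_conv_nth)
  also have "\<dots> = hd (rotate r v)"
    using ne by (cases "rotate r v") auto
  also have "\<dots> = iter (rotate r v) 0"
    using assms ne by (simp add: hd_conv_nth del: rotate_is_Nil_conv)
  finally show ?thesis .
qed

text \<open>
  Equal repetitions make the two words commute, and commuting words are powers of a common word.
\<close>

lemma primitive_word_iter_eqD:
  assumes u: "primitive_word u" and v: "primitive_word v" and eq: "iter u = iter v"
  shows "u = v"
proof -
  have ne: "u \<noteq> []" "v \<noteq> []"
    using u v by (auto simp: primitive_word_def)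
  have append_nth: "(x @ y) ! k = iter x k"
    if "x \<noteq> []" "y \<noteq> []" "iter x = iter y" "k < length x + length y" for x y :: "'a list" and k
  proof (cases "k < length x")
    case True
    then show ?thesis
      using that(1) by (simp add: nth_append)
  next
    case False
    define j where "j = k - length x"
    have k: "k = j + length x" "j < length y"
      using False that by (auto simp: j_def)
    have "(x @ y) ! k = iter y j"
      using k that(1,2) by (simp add: nth_append)
    also have "\<dots> = iter x j"
      using that(3) by simp
    also have "\<dots> = iter x k"
      using k(1) that(1) by simp
    finally show ?thesis .
  qed
  have "u @ v = v @ u"
    using append_nth[of u v] append_nth[of v u] ne eq by (intro nth_equalityI) auto
  then obtain m n z where mz: "concat (replicate m z) = u" and nz: "concat (replicate n z) = v"
    using comm_append_are_replicate by blast
  have "m = 1"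
    using u mz ne(1) unfolding primitive_word_def
    by (metis One_nat_def concat.simps(1) less_2_cases not_less replicate_0)
  moreover have "n = 1"
    using v nz ne(2) unfolding primitive_word_def
    by (metis One_nat_def concat.simps(1) less_2_cases not_less replicate_0)
  ultimately show ?thesis
    using mz nz by simp
qed

text \<open>
  Primitivity passes to rotations, because a rotation of a power is a power.
\<close>

lemma rotate_concat_replicate: "\<exists>z. rotate r (concat (replicate m u)) = concat (replicate m z)"
proof (induction r)
  case 0
  then show ?case by auto
next
  case (Suc r)
  have rot1: "\<exists>z. rotate1 (concat (replicate m w)) = concat (replicate m z)" for w :: "'a list"
  proof (cases w)
    case Nil
    then show ?thesis
      by (intro exI[of _ "[]"]) (metis concat_replicate_trivial rotate1.simps(1))
  next
    case (Cons a w')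
    have shift: "concat (replicate k (a # w')) @ [a] = a # concat (replicate k (w' @ [a]))" for k
      by (induction k) auto
    have "rotate1 (concat (replicate m w)) = concat (replicate m (w' @ [a]))"
      using shift Cons by (cases m) auto
    then show ?thesis
      by blast
  qed
  then show ?case
    using Suc by (metis rotate_Suc)
qed

lemma rotate_inverse: "\<exists>s. rotate s (rotate r v) = v"
proof -
  have "rotate (length v - r mod length v) (rotate (r mod length v) v) = v"
    by (cases "v = []") (simp_all add: rotate_rotate)
  then show ?thesis
    by (metis rotate_conv_mod)
qed

lemma primitive_word_rotate:
  assumes "primitive_word v"
  shows "primitive_word (rotate r v)"
proof -
  have False if m: "m \<ge> 2" and eq: "rotate r v = concat (replicate m u)" for m u
  proof -
    obtain s where "rotate s (rotate r v) = v"
      using rotate_inverse by blast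
    then have "\<exists>z. v = concat (replicate m z)"
      using rotate_concat_replicate[of s m u] eq by metis
    then show False
      using assms m by (auto simp: primitive_word_def)
  qed
  then show ?thesis
    using assms by (auto simp: primitive_word_def)
qed

section \<open>The lexicographic order on infinite words\<close>

lemma lex_less_first_neq:
  assumes "irrefl r" "x 0 \<noteq> y 0"
  shows "lex_less r x y \<longleftrightarrow> (x 0, y 0) \<in> r"
  using assms unfolding lex_less_def by (metis gr0I not_less_zero)

lemma lex_less_first_eq:
  assumes "irrefl r" "x 0 = y 0"
  shows "lex_less r x y \<longleftrightarrow> lex_less r (\<lambda>n. x (Suc n)) (\<lambda>n. y (Suc n))"
proof
  assume "lex_less r x y"
  then obtain n where n: "\<And>m. m < n \<Longrightarrow> x m = y m" "(x n, y n) \<in> r"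
    by (auto simp: lex_less_def)
  then obtain k where "n = Suc k"
    using assms by (cases n) (auto simp: irrefl_def)
  then show "lex_less r (\<lambda>n. x (Suc n)) (\<lambda>n. y (Suc n))"
    using n unfolding lex_less_def by auto
next
  assume "lex_less r (\<lambda>n. x (Suc n)) (\<lambda>n. y (Suc n))"
  then obtain n where n: "\<And>m. m < n \<Longrightarrow> x (Suc m) = y (Suc m)" "(x (Suc n), y (Suc n)) \<in> r"
    by (auto simp: lex_less_def)
  have "x m = y m" if "m < Suc n" for m
    using that n(1) assms(2) by (cases m) auto
  then show "lex_less r x y"
    using n(2) unfolding lex_less_def by blast
qed

lemma lex_less_irrefl: "irrefl r \<Longrightarrow> \<not> lex_less r x x"
  by (auto simp: lex_less_def irrefl_def)

text \<open>
  The two comparisons combine at the earlier of the two positions where they are decided.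
\<close>

lemma lex_less_trans:
  assumes "trans r" "lex_less r x y" "lex_less r y z"
  shows "lex_less r x z"
proof -
  obtain n where n: "\<And>m. m < n \<Longrightarrow> x m = y m" "(x n, y n) \<in> r"
    using assms(2) by (auto simp: lex_less_def)
  obtain k where k: "\<And>m. m < k \<Longrightarrow> y m = z m" "(y k, z k) \<in> r"
    using assms(3) by (auto simp: lex_less_def)
  have "(x (min n k), z (min n k)) \<in> r"
    using n k transD[OF assms(1)] by (cases n k rule: linorder_cases) (auto simp: min_def)
  moreover have "x m = z m" if "m < min n k" for m
    using that n k by auto
  ultimately show ?thesis
    unfolding lex_less_def by blast
qed

section \<open>Parikh vectors\<close>

definition parikh :: "'a::finite list \<Rightarrow> real ^ 'a" where
  "parikh w = (\<chi> a. real (count_list w a))"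

lemma sum_over_word: "(\<Sum>r<length w. g (w ! r)) = (\<Sum>a\<in>UNIV. g a * parikh w $ a)"
  for g :: "'a::finite \<Rightarrow> real"
proof (induction w)
  case Nil
  then show ?case by (simp add: parikh_def)
next
  case (Cons b w)
  have "(\<Sum>r<length (b # w). g ((b # w) ! r)) = g b + (\<Sum>r<length w. g (w ! r))"
    by (simp add: sum.lessThan_Suc_shift del: sum.lessThan_Suc)
  also have "\<dots> = (\<Sum>a\<in>UNIV. g a * (if a = b then 1 else 0)) + (\<Sum>a\<in>UNIV. g a * parikh w $ a)"
    by (simp add: Cons.IH if_distrib cong: if_cong)
  also have "\<dots> = (\<Sum>a\<in>UNIV. g a * parikh (b # w) $ a)"
    by (auto simp: sum.distrib[symmetric] parikh_def algebra_simps intro!: sum.cong)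
  finally show ?case .
qed

section \<open>The discrete interval exchange\<close>

locale clustering_words =
  fixes D A :: "'a::finite rel" and V :: "'a list set"
  assumes D: "strict_linear_order D" and A: "strict_linear_order A"
    and finite_words: "finite V"
    and nonempty: "v \<in> V \<Longrightarrow> v \<noteq> []"
    and cluster: "u \<in> V \<Longrightarrow> v \<in> V \<Longrightarrow>
      less_A A (rotate r u) (rotate s v) \<longleftrightarrow> less_D D (rotate r u) (rotate s v)"
begin

definition total_parikh :: "('a list \<Rightarrow> real) \<Rightarrow> real ^ 'a" where
  "total_parikh c = (\<Sum>v\<in>V. c v *\<^sub>R parikh v)"

text \<open>
  For nonnegative \<open>c\<close>, this is the left endpoint of the interval of \<open>x\<close> when the points are laid
  side by side in \<open>D\<close>-order, each rotation of \<open>v\<close> occupying length \<open>c v\<close>.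
\<close>

definition mass_below :: "('a list \<Rightarrow> real) \<Rightarrow> 'a word \<Rightarrow> real" where
  "mass_below c x =
     (\<Sum>v\<in>V. c v * (\<Sum>r<length v. of_bool (lex_less D (iter (rotate r v)) x)))"

lemma irrefl_D: "irrefl D" and irrefl_A: "irrefl A"
  and trans_D: "trans D" and trans_A: "trans A"
  using D A by (auto simp: strict_linear_order_on_def)

lemma total_D: "a = b \<or> (a, b) \<in> D \<or> (b, a) \<in> D"
  and total_A: "a = b \<or> (a, b) \<in> A \<or> (b, a) \<in> A"
  using D A by (auto simp: strict_linear_order_on_def total_on_def)

lemma asym_D: "(a, b) \<in> D \<Longrightarrow> (b, a) \<notin> D" and asym_A: "(a, b) \<in> A \<Longrightarrow> (b, a) \<notin> A"
  using irrefl_D irrefl_A trans_D trans_A by (meson irrefl_def transD)+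

text \<open>
  For points in one block the shift keeps the order. For different first letters \<open>a\<close> and \<open>b\<close>, the
  comparison before the shift is that of \<open>a\<close> and \<open>b\<close> in \<open>D\<close>, and by clustering the comparison
  after it is that of \<open>a\<close> and \<open>b\<close> in \<open>A\<close>. The matrix \<open>\<Omega>\<close> records exactly this change.
\<close>

lemma lex_shift_diff:
  assumes "u \<in> V" "v \<in> V"
  shows "of_bool (lex_less D (iter (rotate (Suc r) v)) (iter (rotate (Suc s) u)))
       - of_bool (lex_less D (iter (rotate r v)) (iter (rotate s u)))
       = Omega D A $ iter (rotate s u) 0 $ iter (rotate r v) 0"
proof -
  define a where "a = iter (rotate s u) 0"
  define b where "b = iter (rotate r v) 0"
  have ne: "u \<noteq> []" "v \<noteq> []"
    using assms nonempty by auto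
  show ?thesis
  proof (cases "a = b")
    case True
    then have "lex_less D (iter (rotate r v)) (iter (rotate s u)) \<longleftrightarrow>
        lex_less D (iter (rotate (Suc r) v)) (iter (rotate (Suc s) u))"
      using lex_less_first_eq[OF irrefl_D, of "iter (rotate r v)" "iter (rotate s u)"] ne
      unfolding a_def b_def iter_rotate_Suc[OF ne(1), abs_def] iter_rotate_Suc[OF ne(2), abs_def]
      by (simp only: iter_rotate_Suc[symmetric]) 
    moreover have "Omega D A $ a $ b = 0"
      using True irrefl_D by (simp add: Omega_def irrefl_def)
    ultimately show ?thesis
      unfolding a_def b_def by simp
  next
    case False
    have "lex_less D (iter (rotate r v)) (iter (rotate s u)) \<longleftrightarrow> (b, a) \<in> D"
      using lex_less_first_neq[OF irrefl_D] False unfolding a_def b_def by metis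
    moreover have "lex_less D (iter (rotate (Suc r) v)) (iter (rotate (Suc s) u)) \<longleftrightarrow> (b, a) \<in> A"
    proof -
      have "lex_less D (iter (rotate (Suc r) v)) (iter (rotate (Suc s) u)) \<longleftrightarrow>
          lex_less A (iter (rev (rotate (Suc r) v))) (iter (rev (rotate (Suc s) u)))"
        using cluster[OF assms(2,1)] unfolding less_A_def less_D_def by blast
      also have "\<dots> \<longleftrightarrow> (b, a) \<in> A"
        using False lex_less_first_neq[OF irrefl_A] ne
        unfolding a_def b_def by (metis iter_rev_rotate_Suc_0)
      finally show ?thesis .
    qed
    moreover have "of_bool ((b, a) \<in> A) - of_bool ((b, a) \<in> D) = Omega D A $ a $ b"
      using False total_D[of a b] total_A[of a b] asym_D[of a b] asym_A[of a b]
      by (auto simp: Omega_def)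
    ultimately show ?thesis
      unfolding a_def b_def by simp
  qed
qed

lemma matrix_mult_total_parikh:
  "(M *v total_parikh c) $ a = (\<Sum>v\<in>V. c v * (\<Sum>r<length v. M $ a $ (v ! r)))"
proof -
  have "(M *v total_parikh c) $ a = (\<Sum>v\<in>V. c v * (M *v parikh v) $ a)"
    by (simp add: total_parikh_def vec.sum matrix_vector_mult_scaleR
        matrix_vector_mul_linear linear_sum[OF matrix_vector_mul_linear])
  moreover have "(M *v parikh v) $ a = (\<Sum>r<length v. M $ a $ (v ! r))" for v
    by (simp add: sum_over_word matrix_vector_mult_def)
  ultimately show ?thesis
    by simp
qed

text \<open>
  The shift permutes the points, so the mass below the shifted point can be summed over shifted
  points; then the two masses can be compared point by point.
\<close>

lemma mass_below_shift:
  assumes u: "u \<in> V"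
  shows "mass_below c (iter (rotate (Suc s) u)) - mass_below c (iter (rotate s u))
       = (Omega D A *v total_parikh c) $ iter (rotate s u) 0"
proof -
  have cyc: "(\<Sum>r<length v. g (iter (rotate r v))) = (\<Sum>r<length v. g (iter (rotate (Suc r) v)))"
    for g :: "'a word \<Rightarrow> real" and v
    using sum_lessThan_telescope[of "\<lambda>r. g (iter (rotate r v))" "length v"]
    by (simp add: sum_subtractf del: rotate_Suc)
  have "mass_below c (iter (rotate (Suc s) u)) - mass_below c (iter (rotate s u)) =
    (\<Sum>v\<in>V. c v * (\<Sum>r<length v.
       of_bool (lex_less D (iter (rotate (Suc r) v)) (iter (rotate (Suc s) u)))
     - of_bool (lex_less D (iter (rotate r v)) (iter (rotate s u)))))"
    unfolding mass_below_def
      cyc[of "\<lambda>x. of_bool (lex_less D x (iter (rotate (Suc s) u)))"]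
    by (simp add: sum_subtractf right_diff_distrib del: rotate_Suc)
  also have "\<dots> = (\<Sum>v\<in>V. c v * (\<Sum>r<length v. Omega D A $ iter (rotate s u) 0 $ (v ! r)))"
  proof (intro sum.cong refl arg_cong2[where f = "(*)"])
    fix v r assume v: "v \<in> V" and r: "r \<in> {..<length v}"
    have "iter (rotate r v) 0 = v ! r"
      using r by (simp add: iter_rotate_nth[OF nonempty[OF v]] del: iter_nth)
    then show "of_bool (lex_less D (iter (rotate (Suc r) v)) (iter (rotate (Suc s) u)))
        - of_bool (lex_less D (iter (rotate r v)) (iter (rotate s u)))
        = Omega D A $ iter (rotate s u) 0 $ (v ! r)"
      using lex_shift_diff[OF u v] by simp
  qed
  finally show ?thesis
    by (simp add: matrix_mult_total_parikh)
qed

text \<open>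
  With all mass on \<open>v\<close>, the left side is the total translation along the closed orbit of \<open>u\<close>.
\<close>

lemma parikh_isotropic:
  assumes "u \<in> V" "v \<in> V"
  shows "parikh u \<bullet> (Omega D A *v parikh v) = 0"
proof -
  define c where "c = (\<lambda>w. of_bool (w = v) :: real)"
  have c: "total_parikh c = parikh v"
    using assms(2) finite_words
    by (simp add: total_parikh_def c_def of_bool_def if_distrib[of "\<lambda>t. t *\<^sub>R _"] cong: if_cong)
  have "parikh u \<bullet> (Omega D A *v parikh v) = (\<Sum>s<length u. (Omega D A *v parikh v) $ (u ! s))"
    by (simp add: sum_over_word inner_vec_def mult.commute)
  also have "\<dots> = (\<Sum>s<length u.
      mass_below c (iter (rotate (Suc s) u)) - mass_below c (iter (rotate s u)))"
  proof (intro sum.cong refl)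
    fix s assume "s \<in> {..<length u}"
    then have "iter (rotate s u) 0 = u ! s"
      by (simp add: iter_rotate_nth[OF nonempty[OF assms(1)]] del: iter_nth)
    then show "(Omega D A *v parikh v) $ (u ! s) =
        mass_below c (iter (rotate (Suc s) u)) - mass_below c (iter (rotate s u))"
      using mass_below_shift[OF assms(1), of c s] c by simp
  qed
  also have "\<dots> = mass_below c (iter (rotate (length u) u)) - mass_below c (iter (rotate 0 u))"
    by (rule sum_lessThan_telescope)
  finally show ?thesis
    by simp
qed


text \<open>
  The left endpoint of the block of points that begin with \<open>a\<close>. It depends on \<open>c\<close> only through the
  total Parikh vector, which is what makes two weights with equal totals comparable.
\<close>

definition block_start :: "('a list \<Rightarrow> real) \<Rightarrow> 'a \<Rightarrow> real" where
  "block_start c a = (\<Sum>v\<in>V. c v * (\<Sum>r<length v. of_bool ((v ! r, a) \<in> D)))"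

lemma block_start_total_parikh:
  "block_start c a = (\<Sum>b\<in>UNIV. of_bool ((b, a) \<in> D) * total_parikh c $ b)"
proof -
  have "block_start c a = (\<Sum>v\<in>V. \<Sum>b\<in>UNIV. c v * (of_bool ((b, a) \<in> D) * parikh v $ b))"
    by (simp only: block_start_def sum_over_word[of "\<lambda>b. of_bool ((b, a) \<in> D)"] sum_distrib_left)
  also have "\<dots> = (\<Sum>b\<in>UNIV. \<Sum>v\<in>V. c v * (of_bool ((b, a) \<in> D) * parikh v $ b))"
    by (rule sum.swap)
  also have "\<dots> = (\<Sum>b\<in>UNIV. of_bool ((b, a) \<in> D) * total_parikh c $ b)"
    unfolding total_parikh_def sum_component sum_distrib_left
    by (intro sum.cong refl) (simp add: mult.left_commute)
  finally show ?thesis .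
qed

lemma block_start_iter:
  "block_start c a = (\<Sum>v\<in>V. c v * (\<Sum>r<length v. of_bool ((iter (rotate r v) 0, a) \<in> D)))"
  unfolding block_start_def
  by (intro sum.cong refl arg_cong2[where f = "(*)"])
     (simp add: iter_rotate_nth[OF nonempty] del: iter_nth)

lemma block_start_le_mass_below:
  assumes "\<forall>v\<in>V. 0 \<le> c v"
  shows "block_start c (x 0) \<le> mass_below c x"
proof -
  have "lex_less D y x" if "(y 0, x 0) \<in> D" for y
    using that unfolding lex_less_def by blast
  then show ?thesis
    unfolding block_start_iter mass_below_def
    by (intro sum_mono mult_left_mono) (auto simp: of_bool_def assms)
qed

text \<open>
  Every point below the given one lies in a block before \<open>a\<close>; the inequality is strict because the
  given point itself also lies there and has positive mass.
\<close>

lemma mass_below_less_block_start: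
  assumes c: "\<forall>v\<in>V. 0 \<le> c v"
    and u: "u \<in> V" "0 < c u" and a: "(iter (rotate s u) 0, a) \<in> D"
  shows "mass_below c (iter (rotate s u)) < block_start c a"
proof -
  let ?x = "iter (rotate s u)"
  have le: "of_bool (lex_less D y ?x) \<le> (of_bool ((y 0, a) \<in> D) :: real)" for y
  proof (cases "lex_less D y ?x")
    case True
    then have "y 0 = ?x 0 \<or> (y 0, ?x 0) \<in> D"
      using lex_less_first_neq[OF irrefl_D] by metis
    then have "(y 0, a) \<in> D"
      using a transD[OF trans_D] by metis
    then show ?thesis by simp
  qed simp
  have "u \<noteq> []"
    using u nonempty by blast
  then have pos: "s mod length u \<in> {..<length u}"
    by simp
  have "(\<Sum>r<length u. of_bool (lex_less D (iter (rotate r u)) ?x))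
      < (\<Sum>r<length u. of_bool ((iter (rotate r u) 0, a) \<in> D) :: real)"
  proof (rule sum_strict_mono_ex1)
    show "\<exists>r\<in>{..<length u}. of_bool (lex_less D (iter (rotate r u)) ?x)
        < (of_bool ((iter (rotate r u) 0, a) \<in> D) :: real)"
      using pos a lex_less_irrefl[OF irrefl_D] rotate_conv_mod[of s u]
      by (intro bexI[of _ "s mod length u"]) (simp_all del: iter_nth)
  qed (use le in \<open>simp_all del: iter_nth\<close>)
  then have "c u * (\<Sum>r<length u. of_bool (lex_less D (iter (rotate r u)) ?x))
      < c u * (\<Sum>r<length u. of_bool ((iter (rotate r u) 0, a) \<in> D))"
    using u(2) by (rule mult_strict_left_mono)
  then show ?thesis
    unfolding block_start_iter mass_below_def using u(1) c
    by (intro sum_strict_mono_ex1 finite_words ballI mult_left_mono sum_mono le) blast+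
qed

text \<open>
  A point of positive mass starts inside its own block, and the blocks of \<open>c\<close> and \<open>c'\<close> coincide.
  So the position alone determines the letter.
\<close>

lemma first_letter_eqI:
  assumes c: "\<forall>v\<in>V. 0 \<le> c v" and c': "\<forall>v\<in>V. 0 \<le> c' v"
    and total: "total_parikh c = total_parikh c'"
    and u: "u \<in> V" "0 < c u" and v: "v \<in> V" "0 < c' v"
    and mass: "mass_below c (iter (rotate r u)) = mass_below c' (iter (rotate s v))"
  shows "iter (rotate r u) 0 = iter (rotate s v) 0"
proof -
  have "block_start c = block_start c'"
    using total by (simp add: block_start_total_parikh fun_eq_iff)
  then have "(iter (rotate r u) 0, iter (rotate s v) 0) \<notin> D"
      "(iter (rotate s v) 0, iter (rotate r u) 0) \<notin> D"
    using mass mass_below_less_block_start[OF c u] mass_below_less_block_start[OF c' v]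
      block_start_le_mass_below[OF c] block_start_le_mass_below[OF c']
    by (metis not_less)+
  then show ?thesis
    using total_D by blast
qed

text \<open>
  The \<open>D\<close>-least point of the support of \<open>c\<close> has only points of mass zero below it.
\<close>

lemma mass_below_zero_exists:
  assumes c: "\<forall>v\<in>V. 0 \<le> c v" and u: "u \<in> V" "0 < c u"
  obtains v s where "v \<in> V" "0 < c v" "mass_below c (iter (rotate s v)) = 0"
proof -
  define S where "S = (SIGMA v:{v \<in> V. 0 < c v}. {..<length v})"
  define R where "R = (\<lambda>(v, r) (w, s). lex_less D (iter (rotate r v)) (iter (rotate s w)))"
  have "finite S"
    using finite_words by (auto simp: S_def)
  moreover have "S \<noteq> {}"
    using u nonempty[OF u(1)] by (auto simp: S_def)
  moreover have "transp_on S R"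
    using lex_less_trans[OF trans_D] by (auto simp: transp_on_def R_def)
  moreover have "asymp_on S R"
    using lex_less_trans[OF trans_D] lex_less_irrefl[OF irrefl_D]
    by (auto simp: asymp_on_def R_def)
  ultimately obtain p where p: "p \<in> S" "\<forall>q\<in>S. q \<noteq> p \<longrightarrow> \<not> R q p"
    using Finite_Set.bex_min_element by metis
  obtain v s where vs: "p = (v, s)"
    by force
  have min: "\<not> R q p" if "q \<in> S" for q
    using p that vs lex_less_irrefl[OF irrefl_D] by (cases "q = p") (auto simp: R_def)
  have "c w * (\<Sum>r<length w. of_bool (lex_less D (iter (rotate r w)) (iter (rotate s v)))) = 0"
    if w: "w \<in> V" for w
  proof (cases "c w = 0")
    case False
    then have "\<not> lex_less D (iter (rotate r w)) (iter (rotate s v))" if "r < length w" for r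
      using min[of "(w, r)"] that w w c by (auto simp: S_def R_def vs less_le)
    then show ?thesis by simp
  qed simp
  then have "mass_below c (iter (rotate s v)) = 0"
    unfolding mass_below_def by (intro sum.neutral) blast
  then show ?thesis
    using that p(1) by (auto simp: S_def vs)
qed

text \<open>
  Two interval exchanges with the same block lengths translate by the same amounts. Hence the
  least points of the two supports, which start at the same position, stay at equal positions
  under the shift and so have equal letters forever.
\<close>

lemma common_orbit_of_equal_parikh:
  assumes c: "\<forall>v\<in>V. 0 \<le> c v" and c': "\<forall>v\<in>V. 0 \<le> c' v"
    and total: "total_parikh c = total_parikh c'"
    and ex: "\<exists>u\<in>V. 0 < c u" "\<exists>v\<in>V. 0 < c' v"
  obtains u v r s where "u \<in> V" "0 < c u" "v \<in> V" "0 < c' v"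
    "iter (rotate r u) = iter (rotate s v)"
proof -
  obtain u r where u: "u \<in> V" "0 < c u" and ur: "mass_below c (iter (rotate r u)) = 0"
    using ex(1) mass_below_zero_exists[OF c] by blast
  obtain v s where v: "v \<in> V" "0 < c' v" and vs: "mass_below c' (iter (rotate s v)) = 0"
    using ex(2) mass_below_zero_exists[OF c'] by blast
  have mass: "mass_below c (iter (rotate (r + m) u)) = mass_below c' (iter (rotate (s + m) v))" for m
  proof (induction m)
    case 0
    then show ?case using ur vs by simp
  next
    case (Suc m)
    then show ?case
      using mass_below_shift[OF u(1), of c "r + m"] mass_below_shift[OF v(1), of c' "s + m"]
        first_letter_eqI[OF c c' total u v Suc.IH] total
      by (simp del: rotate_Suc iter_nth)
  qed
  have "iter (rotate r u) m = iter (rotate s v) m" for m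
    using first_letter_eqI[OF c c' total u v mass[of m]] nonempty u v
    by (simp add: iter_rotate_nth del: iter_nth)
  then show ?thesis
    using that u v by blast
qed

end

lemma conjugate_of_rotate_eq:
  assumes "rotate r u = rotate s v"
  shows "conjugate u v"
proof -
  obtain t where "rotate t (rotate r u) = u"
    using rotate_inverse by blast
  then show ?thesis
    unfolding conjugate_def using assms by (metis rotate_rotate)
qed

locale primitive_clustering_words = clustering_words +
  assumes primitive: "v \<in> V \<Longrightarrow> primitive_word v"
    and nonconjugate: "u \<in> V \<Longrightarrow> v \<in> V \<Longrightarrow> u \<noteq> v \<Longrightarrow> \<not> conjugate u v"
begin

text \<open>
  Weighing the relation with word lengths shows that a nontrivial relation has coefficients of
  both signs. Its positive and negative parts are then two nonzero weights with equal totals.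
\<close>

lemma parikh_scalars_zero:
  assumes rel: "(\<Sum>v\<in>V. l v *\<^sub>R parikh v) = 0" and "v \<in> V"
  shows "l v = 0"
proof (rule ccontr)
  assume "l v \<noteq> 0"
  \<comment> \<open>The entries of a Parikh vector add up to the length of the word.\<close>
  have "(\<Sum>v\<in>V. l v * real (length v)) = (\<Sum>a\<in>UNIV. (\<Sum>v\<in>V. l v *\<^sub>R parikh v) $ a)"
  proof -
    have "real (length v) = (\<Sum>a\<in>UNIV. parikh v $ a)" for v :: "'a list"
      using sum_over_word[of "\<lambda>_. 1" v] by simp
    then show ?thesis
      unfolding sum_component by (subst sum.swap) (simp add: sum_distrib_left)
  qed
  then have len: "(\<Sum>v\<in>V. l v * real (length v)) = 0"
    using rel by simp
  have "\<exists>u\<in>V. 0 < l u"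
  proof (rule ccontr)
    assume "\<not> ?thesis"
    then have "(\<Sum>v\<in>V. - (l v * real (length v))) = 0 \<longleftrightarrow> (\<forall>v\<in>V. - (l v * real (length v)) = 0)"
      by (intro sum_nonneg_eq_0_iff finite_words) (auto simp: mult_nonpos_nonneg not_less)
    then show False
      using len nonempty \<open>v \<in> V\<close> \<open>l v \<noteq> 0\<close> by (auto simp: sum_negf)
  qed
  then have ex_pos: "\<exists>u\<in>V. 0 < max (l u) 0"
    by (simp add: less_max_iff_disj)
  have "\<exists>u\<in>V. l u < 0"
  proof (rule ccontr)
    assume "\<not> ?thesis"
    then have "(\<Sum>v\<in>V. l v * real (length v)) = 0 \<longleftrightarrow> (\<forall>v\<in>V. l v * real (length v) = 0)"
      by (intro sum_nonneg_eq_0_iff finite_words) (auto simp: not_less)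
    then show False
      using len nonempty \<open>v \<in> V\<close> \<open>l v \<noteq> 0\<close> by auto
  qed
  then have ex_neg: "\<exists>u\<in>V. 0 < max (- l u) 0"
    by (simp add: less_max_iff_disj)
  have "total_parikh (\<lambda>v. max (l v) 0) - total_parikh (\<lambda>v. max (- l v) 0)
      = (\<Sum>v\<in>V. l v *\<^sub>R parikh v)"
    unfolding total_parikh_def sum_subtractf[symmetric] scaleR_left_diff_distrib[symmetric]
    by (intro sum.cong refl arg_cong2[where f = "(*\<^sub>R)"]) auto
  then have total: "total_parikh (\<lambda>v. max (l v) 0) = total_parikh (\<lambda>v. max (- l v) 0)"
    using rel by simp
  obtain u w r s where uw: "u \<in> V" "0 < max (l u) 0" "w \<in> V" "0 < max (- l w) 0"
    and eq: "iter (rotate r u) = iter (rotate s w)"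
    by (rule common_orbit_of_equal_parikh[OF _ _ total ex_pos ex_neg]) simp_all
  have "rotate r u = rotate s w"
    using eq uw primitive primitive_word_rotate primitive_word_iter_eqD by blast
  moreover have "u \<noteq> w"
    using uw by auto
  ultimately show False
    using nonconjugate conjugate_of_rotate_eq uw by blast
qed

text \<open>
  Equal Parikh vectors of two words are a special linear relation.
\<close>

lemma inj_on_parikh: "inj_on parikh V"
proof (rule inj_onI, rule ccontr)
  fix u v assume uv: "u \<in> V" "v \<in> V" "parikh u = parikh v" "u \<noteq> v"
  define l where "l = (\<lambda>w. of_bool (w = u) - of_bool (w = v) :: real)"
  have "(\<Sum>w\<in>V. l w *\<^sub>R parikh w) = parikh u - parikh v"
    using uv finite_words
    by (simp add: l_def scaleR_left_diff_distrib sum_subtractf of_bool_def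
        if_distrib[of "\<lambda>t. t *\<^sub>R _"] cong: if_cong)
  then have "l u = 0"
    using uv parikh_scalars_zero[of l u] by simp
  then show False
    using uv by (simp add: l_def)
qed

lemma independent_parikh: "independent (parikh ` V)"
proof (rule independent_if_scalars_zero)
  fix f x assume "(\<Sum>x\<in>parikh ` V. f x *\<^sub>R x) = 0" "x \<in> parikh ` V"
  then show "f x = 0"
    using parikh_scalars_zero[of "\<lambda>v. f (parikh v)"] by (auto simp: sum.reindex[OF inj_on_parikh])
qed (simp add: finite_words)

end

section \<open>Isotropic subspaces\<close>

text \<open>
  \<open>S\<close> and \<open>M S\<close> are orthogonal, so their dimensions add up to at most \<open>CARD('n)\<close>. The dimension
  of \<open>M S\<close> is bounded below because \<open>M\<close> is injective on \<open>T\<close>, the orthogonal complement, within the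
  span of \<open>S\<close>, of the part \<open>K\<close> of the kernel that lies in this span.
\<close>

lemma dim_isotropic_le:
  fixes M :: "real ^ 'n ^ 'n" and S :: "(real ^ 'n) set"
  assumes iso: "\<And>x y. x \<in> S \<Longrightarrow> y \<in> S \<Longrightarrow> x \<bullet> (M *v y) = 0"
  shows "2 * dim S \<le> CARD('n) + dim {x. M *v x = 0}"
proof -
  define K where "K = {x \<in> span S. M *v x = 0}"
  define T where "T = {y \<in> span S. \<forall>x\<in>K. orthogonal x y}"
  have lin: "linear ((*v) M)"
    by simp
  have subK: "subspace K"
    by (auto simp: K_def subspace_def span_zero span_add span_scale
        matrix_vector_right_distrib matrix_vector_mult_scaleR)
  have dimT: "dim T + dim K = dim S"
    using dim_subspace_orthogonal_to_vectors[OF subK, of "span S"] by (simp add: T_def K_def Collect_restrict)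
  have subT: "subspace T"
    unfolding T_def subspace_def
    by (auto simp: span_zero span_add span_scale orthogonal_clauses)
  have "inj_on ((*v) M) T"
    unfolding linear_inj_on_iff_eq_0[OF lin subT]
    by (auto simp: T_def K_def orthogonal_self)
  then have "dim ((*v) M ` T) = dim T"
    using dim_image_eq[OF lin, of T] span_eq_iff[of T] subT by metis
  moreover have "dim ((*v) M ` T) \<le> dim ((*v) M ` S)"
  proof (rule dim_mono)
    show "(*v) M ` T \<subseteq> span ((*v) M ` S)"
      unfolding linear_span_image[OF lin] by (auto simp: T_def)
  qed
  ultimately have "dim T \<le> dim ((*v) M ` S)"
    by simp
  moreover have "dim (S \<union> (*v) M ` S) = dim S + dim ((*v) M ` S)"
    using iso by (intro dim_orthogonal_sum) auto
  moreover have "dim (S \<union> (*v) M ` S) \<le> CARD('n)"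
    by (rule dim_subset_UNIV_cart)
  moreover have "dim K \<le> dim {x. M *v x = 0}"
    by (rule dim_subset) (auto simp: K_def)
  ultimately show ?thesis
    using dimT by linarith
qed

lemma primitive_clustering_length_le:
  fixes D A :: "'a::finite rel"
  assumes "strict_linear_order D" "strict_linear_order A"
    and prim: "primitive_family F" and clus: "clustering D A F"
  shows "2 * length F \<le> CARD('a) + dim {x. Omega D A *v x = 0}"
proof -
  have conj_refl: "conjugate w w" for w :: "'a list"
    unfolding conjugate_def by (intro exI[of _ 0]) simp
  interpret primitive_clustering_words D A "set F"
  proof
    fix u v r s assume "u \<in> set F" "v \<in> set F"
    then show "less_A A (rotate r u) (rotate s v) \<longleftrightarrow> less_D D (rotate r u) (rotate s v)"
      using clus unfolding clustering_def conjugate_def by (metis in_set_conv_nth)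
  next
    fix u v assume "u \<in> set F" "v \<in> set F" "u \<noteq> v"
    then show "\<not> conjugate u v"
      using prim unfolding primitive_family_def by (metis in_set_conv_nth)
  qed (use assms in \<open>auto simp: clustering_def primitive_family_def in_set_conv_nth\<close>)
  have "distinct F"
    using prim conj_refl unfolding primitive_family_def distinct_conv_nth by metis
  then have "dim (parikh ` set F) = length F"
    using independent_parikh inj_on_parikh
    by (simp add: dim_eq_card_independent card_image distinct_card)
  then show ?thesis
    using dim_isotropic_le[of "parikh ` set F" "Omega D A"] parikh_isotropic by auto
qed

section \<open>Symmetric pairs of orders\<close>

text \<open>
  The coordinate at the least letter \<open>a\<close> is injective on the kernel. Suppose it vanishes at a
  nonzero \<open>x\<close> and let \<open>i\<close> be the least letter with \<open>x $ i \<noteq> 0\<close>. Since \<open>x\<close> vanishes before \<open>i\<close>,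
  row \<open>a\<close> of \<open>\<Omega> x\<close> is the sum of the coordinates from \<open>i\<close> on, and row \<open>i\<close> is the sum of those
  after \<open>i\<close>; both are zero, so \<open>x $ i = 0\<close>.
\<close>

lemma dim_ker_Omega_symmetric_le:
  fixes D A :: "'a::finite rel"
  assumes D: "strict_linear_order D" and sym: "symmetric_orders D A"
  shows "dim {x. Omega D A *v x = 0} \<le> 1"
proof -
  have irr: "irrefl D" and tr: "trans D" and tot: "\<And>a b. a = b \<or> (a, b) \<in> D \<or> (b, a) \<in> D"
    using D by (auto simp: strict_linear_order_on_def total_on_def)
  have asym: "(a, b) \<in> D \<Longrightarrow> (b, a) \<notin> D" for a b
    using irr tr by (meson irrefl_def transD)
  have wf: "wf D"
    using irr tr by (simp add: finite_acyclic_wf acyclic_irrefl)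
  obtain a where a: "\<And>b. (b, a) \<notin> D"
    using wf wfE_min[of D _ UNIV] by (metis UNIV_I)
  have Om: "(Omega D A *v x) $ i = (\<Sum>j\<in>UNIV. (of_bool ((i, j) \<in> D) - of_bool ((j, i) \<in> D)) * x $ j)"
    for x i
    using sym asym by (auto simp: matrix_vector_mult_def Omega_def symmetric_orders_def intro!: sum.cong)
  have zero: "x = 0" if ker: "Omega D A *v x = 0" and xa: "x $ a = 0" for x
  proof (rule ccontr)
    assume "x \<noteq> 0"
    then have "{i. x $ i \<noteq> 0} \<noteq> {}"
      by (auto simp: vec_eq_iff)
    then obtain i where i: "x $ i \<noteq> 0" and least: "\<And>j. (j, i) \<in> D \<Longrightarrow> x $ j = 0"
      using wfE_min'[OF wf, of "{i. x $ i \<noteq> 0}"] by auto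
    have "(a, i) \<in> D"
      using tot[of a i] a i xa by auto
    have "(Omega D A *v x) $ a - (Omega D A *v x) $ i = (\<Sum>j\<in>UNIV. of_bool (j = i) * x $ j)"
      unfolding Om sum_subtractf[symmetric]
    proof (intro sum.cong refl)
      fix j
      consider "(j, i) \<in> D" | "j = i" | "(i, j) \<in> D"
        using tot by blast
      then show "(of_bool ((a, j) \<in> D) - of_bool ((j, a) \<in> D)) * x $ j -
          (of_bool ((i, j) \<in> D) - of_bool ((j, i) \<in> D)) * x $ j = of_bool (j = i) * x $ j"
        using least[of j] asym[of i j] a[of j] \<open>(a, i) \<in> D\<close> transD[OF tr, of a i j] irr
        by cases (auto simp: irrefl_def)
    qed
    then show False
      using ker i by (simp add: of_bool_def if_distrib[of "\<lambda>t. t * _"] cong: if_cong)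
  qed
  let ?K = "{x. Omega D A *v x = 0}"
  have subK: "subspace ?K"
    by (auto simp: subspace_def matrix_vector_right_distrib matrix_vector_mult_scaleR)
  have lin: "linear (\<lambda>x :: real ^ 'a. x $ a)"
    by (intro linearI) auto
  have "inj_on (\<lambda>x :: real ^ 'a. x $ a) ?K"
    unfolding linear_inj_on_iff_eq_0[OF lin subK] using zero by auto
  then have "dim ?K = dim ((\<lambda>x :: real ^ 'a. x $ a) ` ?K)"
    using dim_image_eq[OF lin, of ?K] span_eq_iff[of ?K] subK by metis
  also have "\<dots> \<le> 1"
    using dim_subset_UNIV[of "(\<lambda>x :: real ^ 'a. x $ a) ` ?K"] by simp
  finally show ?thesis .
qed


section \<open>A perfectly clustering family of maximal size\<close>

text \<open>
  Each word is determined by its first letter, and its last letter is the mirror image of the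
  first. So comparing two conjugates by first letters in an order is the same as comparing them by
  last letters in the reversed order. The two conjugates \<open>a \<sigma>(a)\<close> and \<open>\<sigma>(a) a\<close> are counted once
  by letting \<open>a\<close> run over the lower half of the alphabet, including the middle letter if there is
  one.
\<close>

lemma perfectly_clustering_family_exists:
  "\<exists>F :: 'a::finite list list.
     primitive_family F \<and> perfectly_clustering F \<and> length F = (CARD('a) + 1) div 2"
proof -
  define k where "k = CARD('a)"
  obtain g :: "nat \<Rightarrow> 'a" where g: "bij_betw g {..<k} UNIV"
    using ex_bij_betw_nat_finite[of "UNIV :: 'a set"] by (auto simp: k_def atLeast0LessThan)
  define h where "h = inv_into {..<k} g"
  have gh [simp]: "g (h a) = a" and hk: "h a < k" for a
    using g bij_betw_inv_into_right[OF g] inv_into_into[of a g "{..<k}"]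
    by (auto simp: h_def bij_betw_def)
  have hg [simp]: "h (g i) = i" if "i < k" for i
    using bij_betw_inv_into_left[OF g] that by (simp add: h_def)
  define \<sigma> where "\<sigma> a = g (k - 1 - h a)" for a
  have h\<sigma>: "h (\<sigma> a) = k - 1 - h a" for a
    using hk[of a] by (simp add: \<sigma>_def)
  have \<sigma>\<sigma> [simp]: "\<sigma> (\<sigma> a) = a" for a
    using hk[of a] h\<sigma>[of a] by (simp add: \<sigma>_def[of "\<sigma> a"])
  define D where "D = {(a, b). h a < h b}"
  define A where "A = {(a, b). h b < h a}"
  define w where "w a = (if \<sigma> a = a then [a] else [a, \<sigma> a])" for a
  define F where "F = map (\<lambda>i. w (g i)) [0..<(k + 1) div 2]"
  have h_eq: "h a = h b \<longleftrightarrow> a = b" for a b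
    by (metis gh)
  have ords: "strict_linear_order D" "strict_linear_order A"
    using h_eq unfolding D_def A_def strict_linear_order_on_def
    by (auto simp: trans_def irrefl_def total_on_def) (metis linorder_neqE_nat)+
  have sym: "symmetric_orders D A"
    by (simp add: symmetric_orders_def D_def A_def)
  have conj_w: "\<exists>b\<in>{a, \<sigma> a}. u = w b" if "conjugate u (w a)" for u a
  proof -
    have rot1: "rotate1 (w b) = w (\<sigma> b)" for b
      by (auto simp: w_def)
    have "\<exists>b\<in>{a, \<sigma> a}. rotate m (w a) = w b" for m
      by (induction m) (auto simp: rot1)
    then show ?thesis
      using that by (auto simp: conjugate_def)
  qed
  have less_D_w: "less_D D (w a) (w b) \<longleftrightarrow> h a < h b" for a b
  proof (cases "a = b")
    case True
    then show ?thesis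
      using ords(1) by (simp add: less_D_def lex_less_irrefl strict_linear_order_on_def)
  next
    case False
    have "iter (w c) 0 = c" for c
      by (simp add: w_def)
    then show ?thesis
      using False ords(1) lex_less_first_neq[of D "iter (w a)" "iter (w b)"]
      by (simp add: less_D_def D_def strict_linear_order_on_def)
  qed
  have less_A_w: "less_A A (w a) (w b) \<longleftrightarrow> h a < h b" for a b
  proof (cases "a = b")
    case True
    then show ?thesis
      using ords(2) by (simp add: less_A_def lex_less_irrefl strict_linear_order_on_def)
  next
    case False
    have last: "iter (rev (w c)) 0 = \<sigma> c" for c
      by (simp add: w_def)
    have "\<sigma> a \<noteq> \<sigma> b"
      using False \<sigma>\<sigma> by metis
    then have "less_A A (w a) (w b) \<longleftrightarrow> h (\<sigma> b) < h (\<sigma> a)"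
      using ords(2) lex_less_first_neq[of A "iter (rev (w a))" "iter (rev (w b))"]
      by (simp add: less_A_def A_def strict_linear_order_on_def last)
    also have "\<dots> \<longleftrightarrow> h a < h b"
      using hk[of a] hk[of b] by (auto simp: h\<sigma>)
    finally show ?thesis .
  qed
  have "clustering D A F"
    unfolding clustering_def
  proof (intro conjI allI impI)
    fix i assume "i < length F"
    then show "F ! i \<noteq> []"
      by (simp add: F_def w_def)
  next
    fix i j u v
    assume "i < length F" "j < length F" "conjugate u (F ! i)" "conjugate v (F ! j)"
    then have "conjugate u (w (g i))" "conjugate v (w (g j))"
      by (simp_all add: F_def)
    then obtain a b where "u = w a" "v = w b"
      using conj_w by metis
    then show "less_A A u v \<longleftrightarrow> less_D D u v"
      by (simp add: less_A_w less_D_w)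
  qed
  then have "perfectly_clustering F"
    unfolding perfectly_clustering_def using ords sym by blast
  moreover have "primitive_family F"
    unfolding primitive_family_def
  proof (intro conjI allI impI)
    fix i assume i: "i < length F"
    have False if m: "m \<ge> 2" and eq: "w a = concat (replicate m u)" for a m u
    proof (cases u)
      case Nil
      then show False
        using eq by (auto simp: w_def split: if_splits)
    next
      case (Cons x u')
      obtain m' where m': "m = Suc (Suc m')"
        using m by (intro that[of "m - 2"]) simp
      show False
        using eq Cons unfolding m' by (cases u') (auto simp: w_def split: if_splits)
    qed
    moreover have "w a \<noteq> []" for a
      by (simp add: w_def)
    ultimately have "primitive_word (w a)" for a
      unfolding primitive_word_def by blast
    then show "primitive_word (F ! i)"
      using i by (simp add: F_def)
  next
    fix i j assume ij: "i < length F" "j < length F" "i \<noteq> j"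
    then have lt: "i < (k + 1) div 2" "j < (k + 1) div 2"
      by (auto simp: F_def)
    then have k: "i < k" "j < k" "i \<noteq> k - 1 - j"
      using ij(3) by auto
    have w_inj: "a = b" if "w a = w b" for a b
      using that by (auto simp: w_def split: if_splits)
    show "\<not> conjugate (F ! i) (F ! j)"
    proof
      assume "conjugate (F ! i) (F ! j)"
      then obtain b where b: "b \<in> {g j, \<sigma> (g j)}" "w (g i) = w b"
        using conj_w[of "w (g i)" "g j"] lt by (auto simp: F_def)
      then have "h (g i) = h (g j) \<or> h (g i) = h (\<sigma> (g j))"
        using w_inj[OF b(2)] by auto
      then show False
        using k ij(3) by (simp add: h\<sigma>)
    qed
  qed
  moreover have "length F = (CARD('a) + 1) div 2"
    by (simp add: F_def k_def)
  ultimately show ?thesis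
    by blast
qed

theorem corollary6:
  shows
    "(\<forall>(D :: 'a::finite rel) A F.
        strict_linear_order D \<and> strict_linear_order A \<and> D \<noteq> A \<and>
        primitive_family F \<and> clustering D A F \<longrightarrow>
          length F \<le> (CARD('a) + dim {x. Omega D A *v x = 0}) div 2)
     \<and> (\<forall>F :: 'a list list.
        primitive_family F \<and> perfectly_clustering F \<longrightarrow> length F \<le> (CARD('a) + 1) div 2)
     \<and> (\<exists>F :: 'a list list.
        primitive_family F \<and> perfectly_clustering F \<and> length F = (CARD('a) + 1) div 2)"
proof (intro conjI allI impI)
  fix D A :: "'a rel" and F
  assume "strict_linear_order D \<and> strict_linear_order A \<and> D \<noteq> A \<and>
    primitive_family F \<and> clustering D A F"
  then have "2 * length F \<le> CARD('a) + dim {x. Omega D A *v x = 0}"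
    using primitive_clustering_length_le by blast
  then show "length F \<le> (CARD('a) + dim {x. Omega D A *v x = 0}) div 2"
    by linarith
next
  fix F :: "'a list list"
  assume "primitive_family F \<and> perfectly_clustering F"
  then obtain D A where DA: "strict_linear_order D" "strict_linear_order A" "symmetric_orders D A"
      "primitive_family F" "clustering D A F"
    by (auto simp: perfectly_clustering_def)
  then have "2 * length F \<le> CARD('a) + dim {x. Omega D A *v x = 0}"
    by (intro primitive_clustering_length_le)
  also have "\<dots> \<le> CARD('a) + 1"
    using dim_ker_Omega_symmetric_le[OF DA(1,3)] by simp
  finally show "length F \<le> (CARD('a) + 1) div 2"
    by linarith
qed (rule perfectly_clustering_family_exists)

end
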